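(* Let $C_{1,2,l}(N)$ ($1\le l\le \lfloor N/2\rfloor$) denote the coefficient of $(x+1)^{-l}$ in the partial fraction decomposition over $\mathbb{C}$ of $\prod_{j=1}^N\frac{1}{1-x^j}$. Then: (i) for all integers $n\ge 1$, $C_{1,2,n}(2n)=\dfrac{1}{2^{2n}\,n!}$; (ii) for all integers $n\ge 2$, $C_{1,2,n-1}(2n)=\dfrac{n}{2^{2n}\,(n-1)!}$; (iii) for all integers $n\ge 3$, $C_{1,2,n-2}(2n)=\dfrac{18n^3-8n^2+15n+2}{9\cdot 2^{2n+2}\,(n-1)!}$.
   Context: For each integer $N\ge 1$, the Rademacher coefficients $C_{h,k,l}(N)\in\mathbb{C}$ are the unique numbers satisfying $$\prod_{j=1}^N \frac{1}{1-x^j}=\sum_{k=1}^N\ \sum_{\substack{0\le h<k\\ \gcd(h,k)=1}}\ \sum_{l=1}^{\lfloor N/k\rfloor}\frac{C_{h,k,l}(N)}{(x-e^{2\pi i h/k})^l}.$$ For $k=2$ the only admissible $h$ is $h=1$, the corresponding root of unity is $-1$, and $C_{1,2,l}(N)$ is the coefficient of $(x+1)^{-l}$. *)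

theory Defs
  imports "HOL-Analysis.Analysis"
begin

definition rademacher_index :: "nat \<Rightarrow> (nat \<times> nat \<times> nat) set" where
  "rademacher_index N =
     {(h, k, l). 1 \<le> k \<and> k \<le> N \<and> h < k \<and> coprime h k \<and> 1 \<le> l \<and> l \<le> N div k}"

(* The decomposition is an identity of rational functions; it is stated pointwise at every
   complex x that is not a pole, because division by zero yields 0 in HOL. The coefficients are
   set to 0 off the index set, so that the family is unique as a total function. *)
definition is_rademacher_family :: "nat \<Rightarrow> (nat \<Rightarrow> nat \<Rightarrow> nat \<Rightarrow> complex) \<Rightarrow> bool" where
  "is_rademacher_family N C \<longleftrightarrow>
     (\<forall>x::complex. (\<forall>j\<in>{1..N}. x ^ j \<noteq> 1) \<longrightarrow>
        (\<Prod>j=1..N. 1 / (1 - x ^ j)) =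
        (\<Sum>k=1..N. \<Sum>h\<in>{h. h < k \<and> coprime h k}. \<Sum>l=1..N div k.
            C h k l / (x - exp (2 * of_real pi * \<i> * of_nat h / of_nat k)) ^ l)) \<and>
     (\<forall>h k l. (h, k, l) \<notin> rademacher_index N \<longrightarrow> C h k l = 0)"

definition rademacher_coeff :: "nat \<Rightarrow> nat \<Rightarrow> nat \<Rightarrow> nat \<Rightarrow> complex" where
  "rademacher_coeff h k l N = (THE C. is_rademacher_family N C) h k l"

end

theory Submission
  imports Defs "HOL-Complex_Analysis.Laurent_Convergence"
    "HOL-Computational_Algebra.Fundamental_Theorem_Algebra"
begin

text \<open>
  A coefficient of a partial fraction decomposition is a Laurent coefficient: near a root
  $\rho$ only the terms with pole $\rho$ contribute negative powers of $x - \rho$. This gives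
  uniqueness of the Rademacher coefficients and reduces their computation to a local expansion
  (lemma \<open>rademacher_family_coeff\<close>). Existence, without which the definite description
  defining the coefficients would be meaningless, comes from the general decomposition of a
  proper rational function (\<open>partial_fraction_decomposition_exists\<close>), once the roots of
  $\prod_{j \le N} (1 - x^j)$ are identified as the primitive $k$-th roots of unity with
  $k \le N$, each of multiplicity $\lfloor N/k \rfloor$ (\<open>roots_denom_poly\<close> and
  \<open>order_denom_poly\<close>).

  For the values, put $x = X - 1$ and $N = 2n$. Each of the $n$ even exponents $j$ contributes
  exactly one factor $X$ to $1 - (X-1)^j$, and the odd exponents contribute none, so
  $\prod_{j \le 2n} (1 - (X-1)^j) = X^n Q_n$ with $Q_n(0) \ne 0$. Hence the coefficient of
  $(x+1)^{-l}$ is the coefficient of $X^{n-l}$ in $1/Q_n$ (\<open>rademacher_coeff_minus_one\<close>),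
  and the three formulas concern the first three Taylor coefficients of $1/Q_n$. They follow by
  induction on $n$, since $Q_{n+1}/Q_n$ is a product of two explicit factors whose coefficients
  up to $X^2$ are polynomials in $n$ (\<open>inverse_pole_cofactor_nth\<close>).
\<close>

section \<open>Partial fractions\<close>

text \<open>
  Induction on the degree of the denominator. If \<open>a\<close> is a root of order \<open>m\<close> and
  $q = (x-a)^m s$, then subtracting $c_0/(x-a)^m$ with $c_0 = p(a)/s(a)$ makes the numerator
  divisible by $x - a$, which lowers the order of the root by one. Summing over a fixed superset
  \<open>R\<close> of the roots spares the bookkeeping for a root that disappears on the way: its inner
  sum is then empty.
\<close>
lemma partial_fraction_decomposition_exists:
  fixes p q :: "complex poly"
  assumes "q \<noteq> 0" "p = 0 \<or> degree p < degree q" "finite R" "{r. poly q r = 0} \<subseteq> R"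
  shows "\<exists>c. \<forall>x. poly q x \<noteq> 0 \<longrightarrow>
           poly p x / poly q x = (\<Sum>r\<in>R. \<Sum>l=1..order r q. c r l / (x - r) ^ l)"
  using assms
proof (induction "degree q" arbitrary: p q)
  case 0
  then have "p = 0" by auto
  then show ?case by (intro exI[of _ "\<lambda>_ _. 0"]) simp
next
  case (Suc d)
  have "\<not> constant (poly q)"
    using Suc.hyps(2) constant_degree[of q] by simp
  then obtain a where a: "poly q a = 0"
    using fundamental_theorem_of_algebra by blast
  then have aR: "a \<in> R" using Suc.prems by auto
  define m where "m = order a q"
  obtain s where s: "q = [:-a, 1:] ^ m * s" "\<not> [:-a, 1:] dvd s"
    using order_decomp[OF \<open>q \<noteq> 0\<close>, of a] unfolding m_def by blast
  have sa: "poly s a \<noteq> 0" using s(2) by (simp add: poly_eq_0_iff_dvd)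
  have s0: "s \<noteq> 0" using sa by auto
  have "m \<noteq> 0" using a \<open>q \<noteq> 0\<close> order_root[of q a] by (simp add: m_def)
  then obtain m' where m: "m = Suc m'" using not0_implies_Suc by blast
  define q' where "q' = [:-a, 1:] ^ m' * s"
  have qq': "q = [:-a, 1:] * q'" by (simp only: s(1) m q'_def power_Suc mult.assoc)
  have q'0: "q' \<noteq> 0" using \<open>q \<noteq> 0\<close> qq' by auto
  have dq: "degree q = Suc (degree q')"
    using q'0 by (simp add: qq' degree_mult_eq del: mult_pCons_left)
  then have dq': "d = degree q'" using Suc.hyps(2) by simp
  have ds: "degree s < degree q"
    using s0 by (simp add: s(1) m degree_mult_eq degree_power_eq del: power_Suc)
  define c0 where "c0 = poly p a / poly s a"
  have "poly (p - smult c0 s) a = 0" using sa by (simp add: c0_def)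
  then obtain p' where p': "p - smult c0 s = [:-a, 1:] * p'"
    by (metis poly_eq_0_iff_dvd dvdE)
  have dp': "p' = 0 \<or> degree p' < degree q'"
  proof (cases "p' = 0")
    case False
    have "degree (p - smult c0 s) < degree q"
      using Suc.prems(2) ds Suc.hyps(2)
      by (intro degree_diff_less) (auto intro: le_less_trans[OF degree_smult_le])
    then show ?thesis using False dq
      by (simp add: p' degree_mult_eq del: mult_pCons_left)
  qed simp
  have "{r. poly q' r = 0} \<subseteq> R" using Suc.prems(4) qq' by auto
  from Suc.hyps(1)[OF dq' q'0 dp' \<open>finite R\<close> this] obtain c where
    c: "\<And>x. poly q' x \<noteq> 0 \<Longrightarrow>
          poly p' x / poly q' x = (\<Sum>r\<in>R. \<Sum>l=1..order r q'. c r l / (x - r) ^ l)" by blast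
  have ord: "order r q = (if r = a then 1 else 0) + order r q'" for r
  proof -
    have "order r q = order r [:-a, 1:] + order r q'"
      using \<open>q \<noteq> 0\<close> unfolding qq' by (rule order_mult)
    moreover have "order r [:-a, 1:] = (if r = a then 1 else 0)"
      using order_power_n_n[of a 1] by (auto simp: order_0I)
    ultimately show ?thesis by simp
  qed
  have oa: "order a q' = m'" using ord[of a] m m_def by simp
  \<comment> \<open>The new coefficient sits at a position beyond the multiplicity of \<open>a\<close> in \<open>q'\<close>,
    so no coefficient of the smaller decomposition is overwritten.\<close>
  define c' where "c' = (\<lambda>r l. if r = a \<and> l = m then c0 else c r l)"
  have split: "(\<Sum>r\<in>R. \<Sum>l=1..order r q. c' r l / (x - r) ^ l) =
      c0 / (x - a) ^ m + (\<Sum>r\<in>R. \<Sum>l=1..order r q'. c r l / (x - r) ^ l)" for x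
  proof -
    have "(\<Sum>l=1..order r q. c' r l / (x - r) ^ l) =
       (if r = a then c0 / (x - a) ^ m else 0) + (\<Sum>l=1..order r q'. c r l / (x - r) ^ l)" for r
    proof (cases "r = a")
      case True
      have "(\<Sum>l=1..m'. c' a l / (x - a) ^ l) = (\<Sum>l=1..m'. c a l / (x - a) ^ l)"
        by (intro sum.cong) (auto simp: c'_def m)
      then show ?thesis using True oa by (simp add: ord c'_def m)
    next
      case False
      then show ?thesis by (simp add: ord c'_def)
    qed
    then show ?thesis using aR \<open>finite R\<close> by (simp add: sum.distrib)
  qed
  show ?case
  proof (intro exI[of _ c'] allI impI)
    fix x assume x: "poly q x \<noteq> 0"
    then have nz: "x - a \<noteq> 0" "poly q' x \<noteq> 0" "poly s x \<noteq> 0" using qq' q'_def by auto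
    have qx: "poly q x = (x - a) * poly q' x"
      by (simp add: qq' algebra_simps)
    have "poly p x = c0 * poly s x + (x - a) * poly p' x"
      using arg_cong[OF p', of "\<lambda>t. poly t x"] by (simp add: algebra_simps)
    then have "poly p x / poly q x =
        c0 * poly s x / poly q x + (x - a) * poly p' x / poly q x"
      by (simp add: add_divide_distrib)
    also have "(x - a) * poly p' x / poly q x = poly p' x / poly q' x"
      using nz by (simp add: qx)
    also have "c0 * poly s x / poly q x = c0 / (x - a) ^ m"
      using nz by (simp add: s(1))
    finally show "poly p x / poly q x = (\<Sum>r\<in>R. \<Sum>l=1..order r q. c' r l / (x - r) ^ l)"
      using c[OF nz(2)] split by simp
  qed
qed

lemma has_laurent_expansion_shifted_pole:
  "(\<lambda>y. 1 / (z + y - r) ^ l) has_laurent_expansion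
     (if r = z then fls_X_intpow (- int l) else fps_to_fls (inverse ((fps_const (z - r) + fps_X) ^ l)))"
proof (cases "r = z")
  case True
  have "(\<lambda>y. y powi (- int l)) has_laurent_expansion (fls_X_intpow (- int l))"
    by (rule has_laurent_expansion_fps_X_power_int)
  moreover have "y powi (- int l) = 1 / (z + y - r) ^ l" for y
    using True by (simp add: power_int_minus divide_inverse)
  ultimately show ?thesis using True by simp
next
  case False
  have "(\<lambda>y. inverse (((z - r) + y) ^ l)) has_fps_expansion
          inverse ((fps_const (z - r) + fps_X) ^ l)"
    using False by (intro fps_expansion_intros) (simp add: fps_nth_power_0)
  then have "(\<lambda>y. 1 / (z + y - r) ^ l) has_fps_expansion
          inverse ((fps_const (z - r) + fps_X) ^ l)"
    by (simp add: divide_inverse algebra_simps)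
  then show ?thesis using False has_laurent_expansion_fps by auto
qed

text \<open>
  Terms with a pole elsewhere are analytic at the point of expansion and have no negative
  Laurent coefficients; a term with its pole there is a single monomial. The poles are indexed
  by an arbitrary set, so that pairs \<open>(k, h)\<close> can later stand for roots of unity.
\<close>
lemma partial_fraction_coeff_eq_fls_nth:
  assumes "finite I" "inj_on \<rho> I" "i \<in> I" "l0 \<in> {1..m i}"
    and L: "(\<lambda>y. \<Sum>j\<in>I. \<Sum>l=1..m j. c j l / (\<rho> i + y - \<rho> j) ^ l) has_laurent_expansion L"
  shows "fls_nth L (- int l0) = c i l0"
proof -
  define T where "T = (\<lambda>r l. if r = \<rho> i then fls_X_intpow (- int l)
     else fps_to_fls (inverse ((fps_const (\<rho> i - r) + fps_X) ^ l)))"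
  have "(\<lambda>y. \<Sum>j\<in>I. \<Sum>l=1..m j. c j l * (1 / (\<rho> i + y - \<rho> j) ^ l)) has_laurent_expansion
        (\<Sum>j\<in>I. \<Sum>l=1..m j. fls_const (c j l) * T (\<rho> j) l)"
    unfolding T_def
    by (intro has_laurent_expansion_sum has_laurent_expansion_cmult_left
        has_laurent_expansion_shifted_pole)
  with L have "L = (\<Sum>j\<in>I. \<Sum>l=1..m j. fls_const (c j l) * T (\<rho> j) l)"
    using has_laurent_expansion_unique by simp
  then have "fls_nth L (- int l0) =
      (\<Sum>j\<in>I. \<Sum>l=1..m j. c j l * fls_nth (T (\<rho> j) l) (- int l0))"
    by (simp add: fls_nth_sum fls_mult_const_nth)
  also have "\<dots> = (\<Sum>j\<in>I. \<Sum>l=1..m j. if j = i then (if l = l0 then c j l else 0) else 0)"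
    using assms by (intro sum.cong refl) (auto simp: T_def inj_on_eq_iff)
  also have "\<dots> = c i l0"
  proof -
    have "(\<Sum>l=1..m j. if j = i then (if l = l0 then c j l else 0) else 0) =
          (if j = i then c i l0 else 0)" for j
      using assms(4) by simp
    then show ?thesis using assms by simp
  qed
  finally show ?thesis .
qed

section \<open>Primitive roots of unity and the denominator\<close>

definition unit_root :: "nat \<Rightarrow> nat \<Rightarrow> complex" where
  "unit_root h k = exp (2 * of_real pi * \<i> * of_nat h / of_nat k)"

lemma unit_root_power_eq_1_iff:
  assumes "coprime h k" "k \<ge> 1"
  shows "unit_root h k ^ j = 1 \<longleftrightarrow> k dvd j"
proof -
  have "unit_root h k ^ j = exp (2 * of_real pi * \<i> * of_nat (j * h) / of_nat k)"
    by (simp add: unit_root_def exp_of_nat_mult [symmetric] mult_ac)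
  then show ?thesis
    using complex_root_unity_eq_1[OF assms(2), of "j * h"] assms(1)
    by (simp add: coprime_dvd_mult_left_iff coprime_commute)
qed

text \<open>A fraction $i/j$ in the exponent is brought to lowest terms $h/k$.\<close>
lemma root_of_unity_eq_unit_root:
  assumes "z ^ j = 1" "j \<ge> 1"
  obtains h k where "1 \<le> k" "k \<le> j" "h < k" "coprime h k" "z = unit_root h k"
proof -
  have "z \<in> {exp (2 * of_real pi * \<i> * of_nat i / of_nat j) | i. i < j}"
    using assms complex_roots_unity[OF assms(2)] by blast
  then obtain i where i: "i < j" "z = exp (2 * of_real pi * \<i> * of_nat i / of_nat j)" by auto
  define g where "g = gcd i j"
  have g: "g > 0" using assms(2) by (simp add: g_def)
  obtain h k where hk: "i = h * g" "j = k * g" "coprime h k"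
    using gcd_coprime_exists[of i j] g unfolding g_def by auto
  show ?thesis
  proof (rule that)
    show "1 \<le> k" using hk assms(2) by (cases k) auto
    show "k \<le> j" using hk g by simp
    show "h < k" using hk i g by simp
    show "coprime h k" by fact
    show "z = unit_root h k" using g by (simp add: i(2) hk(1,2) unit_root_def mult.assoc)
  qed
qed

definition root_index :: "nat \<Rightarrow> (nat \<times> nat) set" where
  "root_index N = (SIGMA k:{1..N}. {h. h < k \<and> coprime h k})"

lemma finite_root_index [simp]: "finite (root_index N)"
  by (auto simp: root_index_def)

text \<open>
  The exponents \<open>j\<close> with $\rho^j = 1$ are the multiples of \<open>k\<close>, so the root $\rho$
  determines \<open>k\<close>, and then \<open>h\<close> modulo \<open>k\<close>.
\<close>
lemma inj_on_unit_root: "inj_on (\<lambda>(k, h). unit_root h k) (root_index N)"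
proof (rule inj_onI, clarify)
  fix k h k' h'
  assume A: "(k, h) \<in> root_index N" "(k', h') \<in> root_index N"
    and eq: "unit_root h k = unit_root h' k'"
  have "k dvd j \<longleftrightarrow> k' dvd j" for j
    using A eq unit_root_power_eq_1_iff[of h k j] unit_root_power_eq_1_iff[of h' k' j]
    by (auto simp: root_index_def)
  then have "k = k'" by (meson dvd_antisym dvd_refl)
  then show "k = k' \<and> h = h'"
    using A eq complex_root_unity_eq[of k h h'] by (auto simp: root_index_def unit_root_def)
qed

definition denom_poly :: "nat \<Rightarrow> complex poly" where
  "denom_poly N = (\<Prod>j=1..N. 1 - monom 1 j)"

lemma poly_denom_poly: "poly (denom_poly N) x = (\<Prod>j=1..N. 1 - x ^ j)"
  by (simp add: denom_poly_def poly_prod poly_monom)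

lemma denom_poly_nonzero: "denom_poly N \<noteq> 0"
proof -
  have "poly (denom_poly N) 0 \<noteq> 0" by (simp add: poly_denom_poly power_0_left)
  then show ?thesis by auto
qed

lemma poly_denom_poly_eq_0_iff: "poly (denom_poly N) x = 0 \<longleftrightarrow> (\<exists>j\<in>{1..N}. x ^ j = 1)"
  by (auto simp: poly_denom_poly)

lemma roots_denom_poly:
  "{x. poly (denom_poly N) x = 0} = (\<lambda>(k, h). unit_root h k) ` root_index N"
proof (intro equalityI subsetI)
  fix x assume "x \<in> {x. poly (denom_poly N) x = 0}"
  then obtain j where j: "j \<in> {1..N}" "x ^ j = 1" by (auto simp: poly_denom_poly_eq_0_iff)
  then obtain h k where "1 \<le> k" "k \<le> j" "h < k" "coprime h k" "x = unit_root h k"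
    using root_of_unity_eq_unit_root[of x j] by (metis atLeastAtMost_iff)
  then show "x \<in> (\<lambda>(k, h). unit_root h k) ` root_index N"
    using j by (auto simp: root_index_def intro!: image_eqI[of _ _ "(k, h)"])
next
  fix x assume "x \<in> (\<lambda>(k, h). unit_root h k) ` root_index N"
  then obtain k h where "x = unit_root h k" "k \<in> {1..N}" "coprime h k"
    by (auto simp: root_index_def)
  then show "x \<in> {x. poly (denom_poly N) x = 0}"
    using unit_root_power_eq_1_iff[of h k k] by (auto simp: poly_denom_poly_eq_0_iff)
qed

text \<open>
  The derivative of $1 - x^j$ vanishes at most at \<open>0\<close>, which is not a root; so all roots
  are simple.
\<close>
lemma order_one_minus_monom:
  fixes z :: complex
  assumes "j \<ge> 1"
  shows "order z (1 - monom 1 j) = (if z ^ j = 1 then 1 else 0)"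
proof (cases "z ^ j = 1")
  case True
  have "rsquarefree (1 - monom 1 j :: complex poly)"
    using assms by (auto simp: rsquarefree_roots pderiv_diff pderiv_monom poly_monom power_0_left)
  moreover have "1 - monom 1 j \<noteq> (0 :: complex poly)"
    using calculation by (simp add: rsquarefree_def)
  ultimately show ?thesis using True rsquarefree_root_order[of "1 - monom 1 j" z]
    by (simp add: poly_monom)
qed (simp add: order_0I poly_monom)

lemma order_prod:
  fixes f :: "'b \<Rightarrow> 'a::idom poly"
  assumes "finite A" "\<And>x. x \<in> A \<Longrightarrow> f x \<noteq> 0"
  shows "order z (\<Prod>x\<in>A. f x) = (\<Sum>x\<in>A. order z (f x))"
  using assms by (induction A rule: finite_induct) (simp_all add: order_mult)

lemma card_multiples_atLeastAtMost:
  assumes "k \<ge> 1"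
  shows "card {j\<in>{1..N}. k dvd j} = N div k"
proof -
  have "{j\<in>{1..N}. k dvd j} = (\<lambda>i. k * i) ` {1..N div k}"
    using assms by (auto simp: dvd_def less_eq_div_iff_mult_less_eq mult.commute)
  then show ?thesis using assms by (simp add: card_image inj_on_def)
qed

text \<open>
  A primitive \<open>k\<close>-th root of unity is a simple root of $1 - x^j$ exactly when \<open>k\<close> divides
  \<open>j\<close>, so its multiplicity counts the multiples of \<open>k\<close> up to \<open>N\<close>. This is what makes
  the range of \<open>l\<close> in the Rademacher decomposition the right one.
\<close>
lemma order_denom_poly:
  assumes "(k, h) \<in> root_index N"
  shows "order (unit_root h k) (denom_poly N) = N div k"
proof -
  have k: "k \<ge> 1" "coprime h k" using assms by (auto simp: root_index_def)
  have nz: "1 - monom 1 j \<noteq> (0 :: complex poly)" if "j \<in> {1..N}" for j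
    using denom_poly_nonzero[of N] that by (auto simp: denom_poly_def)
  have "order (unit_root h k) (denom_poly N) = (\<Sum>j=1..N. if k dvd j then 1 else 0)"
    unfolding denom_poly_def using nz k
    by (subst order_prod) (auto simp: order_one_minus_monom unit_root_power_eq_1_iff intro!: sum.cong)
  also have "\<dots> = card {j\<in>{1..N}. k dvd j}"
    by (simp add: sum.If_cases Int_def)
  finally show ?thesis using card_multiples_atLeastAtMost[OF k(1)] by simp
qed

section \<open>Rademacher coefficients as Laurent coefficients\<close>

lemma rademacher_sum_eq:
  "(\<Sum>k=1..N. \<Sum>h\<in>{h. h < k \<and> coprime h k}. \<Sum>l=1..N div k.
      C h k l / (x - exp (2 * of_real pi * \<i> * of_nat h / of_nat k)) ^ l) =
   (\<Sum>(k, h)\<in>root_index N. \<Sum>l=1..N div k. C h k l / (x - unit_root h k) ^ l)"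
  unfolding root_index_def by (subst sum.Sigma) (auto simp: unit_root_def)

lemma eventually_denom_poly_nonzero:
  "eventually (\<lambda>y. poly (denom_poly N) (z + y) \<noteq> 0) (at 0)"
proof -
  have "finite {y. poly (denom_poly N) (z + y) = 0}"
  proof (rule finite_subset)
    show "{y. poly (denom_poly N) (z + y) = 0} \<subseteq> (\<lambda>x. x - z) ` {x. poly (denom_poly N) x = 0}"
      by (auto intro!: image_eqI)
  qed (simp add: poly_roots_finite denom_poly_nonzero)
  then have "\<not> 0 islimpt {y. poly (denom_poly N) (z + y) = 0}"
    by (rule islimpt_finite)
  then show ?thesis
    by (simp add: islimpt_iff_eventually)
qed

text \<open>
  The defining identity holds off the finitely many poles, hence on a punctured neighbourhood of
  each root, which is all that a Laurent expansion sees. As \<open>L\<close> depends only on the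
  product, this also yields uniqueness of the family.
\<close>
lemma rademacher_family_coeff:
  assumes C: "is_rademacher_family N C" and idx: "(h, k, l) \<in> rademacher_index N"
    and L: "(\<lambda>y. \<Prod>j=1..N. 1 / (1 - (unit_root h k + y) ^ j)) has_laurent_expansion L"
  shows "C h k l = fls_nth L (- int l)"
proof -
  let ?\<rho> = "\<lambda>(k, h). unit_root h k"
  let ?S = "\<lambda>y. \<Sum>i\<in>root_index N. \<Sum>l=1..N div fst i.
      C (snd i) (fst i) l / (?\<rho> (k, h) + y - ?\<rho> i) ^ l"
  have "eventually (\<lambda>y. (\<Prod>j=1..N. 1 / (1 - (unit_root h k + y) ^ j)) = ?S y) (at 0)"
    using eventually_denom_poly_nonzero[of N "unit_root h k"]
  proof eventually_elim
    case (elim y)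
    then show ?case
      using C unfolding is_rademacher_family_def rademacher_sum_eq
      by (auto simp: poly_denom_poly_eq_0_iff case_prod_unfold)
  qed
  then have "?S has_laurent_expansion L"
    using L by (subst has_laurent_expansion_cong[symmetric]) auto
  moreover have "(k, h) \<in> root_index N" "l \<in> {1..N div fst (k, h)}"
    using idx by (auto simp: root_index_def rademacher_index_def)
  ultimately show ?thesis
    using partial_fraction_coeff_eq_fls_nth[of "root_index N" ?\<rho> "(k, h)" l "\<lambda>i. N div fst i"
        "\<lambda>i. C (snd i) (fst i)" L] inj_on_unit_root
    by simp
qed

lemma has_laurent_expansion_rademacher_product:
  "(\<lambda>y. \<Prod>j=1..N. 1 / (1 - (z + y) ^ j)) has_laurent_expansion
     (\<Prod>j=1..N. 1 / (1 - (fls_const z + fls_X) ^ j))"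
  by (intro laurent_expansion_intros)

lemma rademacher_family_exists:
  assumes "N \<ge> 1"
  shows "\<exists>C. is_rademacher_family N C"
proof -
  let ?q = "denom_poly N"
  let ?\<rho> = "\<lambda>(k, h). unit_root h k"
  have "poly ?q 1 = 0" using assms by (auto simp: poly_denom_poly_eq_0_iff)
  then have "degree ?q > 0"
    using denom_poly_nonzero[of N] by (auto intro!: Nat.gr0I elim!: degree_eq_zeroE)
  then obtain c where c: "\<And>x. poly ?q x \<noteq> 0 \<Longrightarrow> poly 1 x / poly ?q x =
      (\<Sum>r\<in>?\<rho> ` root_index N. \<Sum>l=1..order r ?q. c r l / (x - r) ^ l)"
    using partial_fraction_decomposition_exists[of ?q 1 "?\<rho> ` root_index N"]
      roots_denom_poly[of N] denom_poly_nonzero[of N] by auto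
  define C where "C = (\<lambda>h k l. if (h, k, l) \<in> rademacher_index N then c (unit_root h k) l else 0)"
  have "is_rademacher_family N C"
    unfolding is_rademacher_family_def rademacher_sum_eq
  proof (intro conjI allI impI)
    fix x :: complex assume x: "\<forall>j\<in>{1..N}. x ^ j \<noteq> 1"
    then have "poly ?q x \<noteq> 0" by (auto simp: poly_denom_poly_eq_0_iff)
    have "(\<Prod>j=1..N. 1 / (1 - x ^ j)) = poly 1 x / poly ?q x"
      by (simp add: poly_denom_poly prod_dividef)
    also have "\<dots> = (\<Sum>r\<in>?\<rho> ` root_index N. \<Sum>l=1..order r ?q. c r l / (x - r) ^ l)"
      by (rule c) fact
    also have "\<dots> = (\<Sum>(k, h)\<in>root_index N. \<Sum>l=1..N div k. C h k l / (x - unit_root h k) ^ l)"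
      unfolding sum.reindex[OF inj_on_unit_root]
      by (intro sum.cong refl)
         (auto simp: order_denom_poly C_def rademacher_index_def root_index_def intro!: sum.cong)
    finally show "(\<Prod>j=1..N. 1 / (1 - x ^ j)) =
        (\<Sum>(k, h)\<in>root_index N. \<Sum>l=1..N div k. C h k l / (x - unit_root h k) ^ l)" .
  qed (simp add: C_def)
  then show ?thesis by blast
qed

lemma is_rademacher_family_THE:
  assumes "N \<ge> 1"
  shows "is_rademacher_family N (THE C. is_rademacher_family N C)"
proof -
  obtain C where C: "is_rademacher_family N C"
    using rademacher_family_exists[OF assms] by blast
  have "D = C" if D: "is_rademacher_family N D" for D
  proof (intro ext)
    fix h k l
    show "D h k l = C h k l"
    proof (cases "(h, k, l) \<in> rademacher_index N")
      case True
      show ?thesis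
        using rademacher_family_coeff[OF C True has_laurent_expansion_rademacher_product]
          rademacher_family_coeff[OF D True has_laurent_expansion_rademacher_product] by simp
    next
      case False
      then show ?thesis using C D by (simp add: is_rademacher_family_def)
    qed
  qed
  with C show ?thesis by (metis theI)
qed

section \<open>The expansion at minus one\<close>

text \<open>
  Both factors are series in $X = x + 1$. For even \<open>j\<close> the series $1 - (X-1)^j$ has no
  constant term, and the shift divides it by $X$.
\<close>

definition odd_factor :: "nat \<Rightarrow> complex fps" where
  "odd_factor j = 1 - (fps_X - 1) ^ j"

definition even_factor :: "nat \<Rightarrow> complex fps" where
  "even_factor j = fps_shift 1 (1 - (fps_X - 1) ^ j)"

definition pole_cofactor :: "nat \<Rightarrow> complex fps" where
  "pole_cofactor n = (\<Prod>i<n. odd_factor (2 * i + 1) * even_factor (2 * i + 2))"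

text \<open>
  These are signed binomial coefficients, written as polynomials in \<open>j\<close> so that the recursion
  for the inverse series becomes polynomial arithmetic. The index \<open>3\<close> is required because
  dividing by $X$ shifts the even factors by one.
\<close>
lemma fps_X_minus_1_power_nth:
  fixes j :: nat
  defines "P \<equiv> ((fps_X - 1) ^ j :: complex fps)"
  shows "fps_nth P 0 = (-1) ^ j"
    and "fps_nth P (Suc 0) = - ((-1) ^ j * of_nat j)"
    and "fps_nth P 2 = (-1) ^ j * (of_nat j * (of_nat j - 1) / 2)"
    and "fps_nth P 3 = - ((-1) ^ j * (of_nat j * (of_nat j - 1) * (of_nat j - 2) / 6))"
  unfolding P_def
proof (induction j)
  case (Suc j)
  let ?P = "(fps_X - 1) ^ j :: complex fps"
  have "(fps_X - 1) ^ Suc j = fps_X * ?P - ?P"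
    by (simp add: left_diff_distrib)
  then have rec: "fps_nth ((fps_X - 1) ^ Suc j :: complex fps) i =
      (if i = 0 then 0 else fps_nth ?P (i - 1)) - fps_nth ?P i" for i
    by (simp only: fps_sub_nth fps_X_mult_nth)
  {
    case 1 show ?case using Suc rec[of 0] by simp
  next
    case 2 show ?case using Suc rec[of 1] by (simp add: algebra_simps)
  next
    case 3 show ?case using Suc rec[of 2] by (simp add: field_simps)
  next
    case 4
    have "fps_nth ((fps_X - 1) ^ Suc j :: complex fps) 3 = fps_nth ?P 2 - fps_nth ?P 3"
      using rec[of 3] by simp
    also have "\<dots> = - ((-1) ^ Suc j * (of_nat (Suc j) * (of_nat (Suc j) - 1) * (of_nat (Suc j) - 2) / 6))"
      unfolding Suc.IH(3,4) by (simp add: field_simps)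
    finally show ?case .
  }
qed simp_all

lemma odd_factor_nth:
  assumes "odd j"
  shows "fps_nth (odd_factor j) 0 = 2"
    and "fps_nth (odd_factor j) (Suc 0) = - of_nat j"
    and "fps_nth (odd_factor j) 2 = of_nat j * (of_nat j - 1) / 2"
  using assms by (simp_all add: odd_factor_def fps_X_minus_1_power_nth)

lemma even_factor_nth:
  assumes "even j"
  shows "fps_nth (even_factor j) 0 = of_nat j"
    and "fps_nth (even_factor j) (Suc 0) = - (of_nat j * (of_nat j - 1) / 2)"
    and "fps_nth (even_factor j) 2 = of_nat j * (of_nat j - 1) * (of_nat j - 2) / 6"
  using assms
  by (simp_all add: even_factor_def fps_X_minus_1_power_nth numeral_2_eq_2[symmetric]
        numeral_3_eq_3[symmetric])

lemma fps_X_times_even_factor: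
  assumes "even j"
  shows "fps_X * even_factor j = 1 - (fps_X - 1) ^ j"
proof (rule fps_ext)
  fix i show "fps_nth (fps_X * even_factor j) i = fps_nth (1 - (fps_X - 1) ^ j) i"
    using assms by (cases i) (simp_all add: even_factor_def fps_X_minus_1_power_nth)
qed

lemma prod_one_minus_shifted_power:
  "(\<Prod>j=1..2 * n. 1 - (fps_X - 1) ^ j) = fps_X ^ n * pole_cofactor n"
proof (induction n)
  case (Suc n)
  have "(\<Prod>j=1..2 * Suc n. 1 - (fps_X - 1) ^ j) =
      (\<Prod>j=1..2 * n. 1 - (fps_X - 1) ^ j) * odd_factor (2 * n + 1) *
        (1 - (fps_X - 1 :: complex fps) ^ (2 * n + 2))"
    by (simp add: odd_factor_def)
  also have "1 - (fps_X - 1 :: complex fps) ^ (2 * n + 2) = fps_X * even_factor (2 * n + 2)"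
    by (rule fps_X_times_even_factor [symmetric]) simp
  finally show ?case unfolding Suc by (simp add: pole_cofactor_def mult_ac)
qed (simp add: pole_cofactor_def)

lemma pole_cofactor_nth_0: "fps_nth (pole_cofactor n) 0 \<noteq> 0"
  by (induction n) (simp_all add: pole_cofactor_def odd_factor_nth even_factor_nth del: of_nat_Suc)

lemma rademacher_coeff_minus_one:
  assumes "1 \<le> l" "l \<le> n"
  shows "rademacher_coeff 1 2 l (2 * n) = fps_nth (inverse (pole_cofactor n)) (n - l)"
proof -
  let ?Q = "pole_cofactor n"
  let ?P = "\<Prod>j=1..2 * n. 1 - (fps_X - 1 :: complex fps) ^ j"
  let ?L = "fls_shift (int n) (fps_to_fls (inverse ?Q))"
  have "(\<lambda>y. \<Prod>j=1..2 * n. 1 - (y - 1) ^ j) has_fps_expansion ?P"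
    by (intro fps_expansion_intros)
  then have "(\<lambda>y. inverse (\<Prod>j=1..2 * n. 1 - (y - 1) ^ j)) has_laurent_expansion
      inverse (fps_to_fls ?P)"
    by (intro has_laurent_expansion_inverse has_laurent_expansion_fps)
  moreover have "inverse (fps_to_fls ?P) = ?L"
  proof (rule inverse_unique)
    have "fps_to_fls ?P * ?L = fls_shift (- int n) (fps_to_fls ?Q) * ?L"
      unfolding prod_one_minus_shifted_power
      by (simp add: fls_times_fps_to_fls fps_to_fls_power fls_X_power_times_conv_shift)
    also have "\<dots> = fps_to_fls (?Q * inverse ?Q)"
      by (simp add: fls_shifted_times_simps fls_times_fps_to_fls)
    also have "?Q * inverse ?Q = 1"
      using pole_cofactor_nth_0 inverse_mult_eq_1' by blast
    finally show "fps_to_fls ?P * ?L = 1" by simp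
  qed
  moreover have "unit_root 1 2 = -1"
    by (simp add: unit_root_def)
  ultimately have L: "(\<lambda>y. \<Prod>j=1..2 * n. 1 / (1 - (unit_root 1 2 + y) ^ j)) has_laurent_expansion ?L"
    by (simp add: divide_inverse prod_inversef [symmetric] o_def)
  have "(1, 2, l) \<in> rademacher_index (2 * n)"
    using assms by (auto simp: rademacher_index_def)
  moreover have "is_rademacher_family (2 * n) (THE C. is_rademacher_family (2 * n) C)"
    using assms by (intro is_rademacher_family_THE) auto
  ultimately have "rademacher_coeff 1 2 l (2 * n) = fls_nth ?L (- int l)"
    unfolding rademacher_coeff_def using L by (intro rademacher_family_coeff)
  also have "\<dots> = fps_nth (inverse ?Q) (n - l)"
    using assms by (simp add: nat_diff_distrib')
  finally show ?thesis .
qed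

lemma fps_mult_nth_2:
  "fps_nth (f * g) 2 = fps_nth f 0 * fps_nth g 2 + fps_nth f 1 * fps_nth g 1 + fps_nth f 2 * fps_nth g 0"
  by (simp add: fps_mult_nth numeral_2_eq_2)

text \<open>
  With $G_n = 1/Q_n$ and $H = Q_{n+1}/Q_n$ one has $G_{n+1} H = G_n$, and comparing the
  coefficients of $1, X, X^2$ determines those of $G_{n+1}$ one after the other because
  $H(0) = 4(n+1)$ is nonzero. Relative to the constant term, the other two are polynomials
  in \<open>n\<close>: the linear coefficient of $1/H$ is $2n + 1$ times its constant term, which
  sums to $n^2$, and the quadratic one arises by summing likewise.
\<close>
lemma inverse_pole_cofactor_nth:
  fixes n :: nat
  defines "G \<equiv> inverse (pole_cofactor n)" and "u \<equiv> 1 / (2 ^ (2 * n) * fact n :: complex)"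
  shows "fps_nth G 0 = u \<and> fps_nth G 1 = of_nat n ^ 2 * u \<and>
    fps_nth G 2 = of_nat n * (18 * of_nat n ^ 3 - 8 * of_nat n ^ 2 + 15 * of_nat n + 2) / 36 * u"
  unfolding G_def u_def
proof (induction n)
  case 0
  then show ?case by (simp add: pole_cofactor_def)
next
  case (Suc n)
  define H where "H = odd_factor (2 * n + 1) * even_factor (2 * n + 2)"
  define g where "g = inverse (pole_cofactor n)"
  define g' where "g' = inverse (pole_cofactor (Suc n))"
  define t :: complex where "t = of_nat n"
  define v :: complex where "v = 1 / (2 ^ (2 * Suc n) * fact (Suc n))"
  have t1: "4 * (t + 1) \<noteq> 0"
    unfolding t_def by (metis of_nat_Suc of_nat_neq_0 add.commute mult_eq_0_iff zero_neq_numeral)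
  have QH: "pole_cofactor (Suc n) = pole_cofactor n * H"
    by (simp add: pole_cofactor_def H_def)
  have H0: "fps_nth H 0 \<noteq> 0"
    using pole_cofactor_nth_0[of "Suc n"] by (simp add: QH)
  have "g' * H = g * (inverse H * H)"
    by (simp add: g'_def g_def QH fps_inverse_mult mult_ac)
  also have "inverse H * H = 1" using H0 by (rule inverse_mult_eq_1)
  finally have gH: "g' * H = g" by simp
  have h0: "fps_nth H 0 = 4 * (t + 1)"
    by (simp add: H_def odd_factor_nth even_factor_nth t_def algebra_simps)
  have h1: "fps_nth H 1 = - (2 * t + 1) * (t + 1) * 4"
    by (simp add: H_def fps_mult_nth_1 odd_factor_nth even_factor_nth t_def field_simps)
  have h2: "fps_nth H 2 = 2 * (t * (2 * t + 1) * (2 * t + 2)) / 3 + (2 * t + 1)^2 * (t + 1)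
      + (2 * t + 1) * t * (2 * t + 2)"
    by (simp add: H_def fps_mult_nth_2 odd_factor_nth even_factor_nth t_def field_simps
        power2_eq_square)
  \<comment> \<open>All coefficients are expressed through \<open>v\<close>, the constant term for \<open>Suc n\<close>, so that
    no factorials or powers of two remain.\<close>
  have u: "1 / (2 ^ (2 * n) * fact n) = 4 * (t + 1) * v"
  proof -
    have "v = 1 / (2 ^ (2 * n) * fact n) / (4 * (t + 1))"
      by (simp add: v_def t_def add.commute)
    then show ?thesis using t1 by (metis nonzero_eq_divide_eq mult.commute)
  qed
  have IH: "fps_nth g 0 = 4 * (t + 1) * v" "fps_nth g 1 = t ^ 2 * (4 * (t + 1) * v)"
    "fps_nth g 2 = t * (18 * t ^ 3 - 8 * t ^ 2 + 15 * t + 2) / 36 * (4 * (t + 1) * v)"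
    using Suc unfolding u by (simp_all add: g_def t_def)
  have "fps_nth g' 0 * fps_nth H 0 = fps_nth g 0"
    using arg_cong[OF gH, of "\<lambda>f. fps_nth f 0"] by simp
  then have c0: "fps_nth g' 0 = v"
    unfolding IH h0 using t1 by (metis mult_right_cancel mult.commute)
  have "fps_nth g' 0 * fps_nth H 1 + fps_nth g' 1 * fps_nth H 0 = fps_nth g 1"
    using arg_cong[OF gH, of "\<lambda>f. fps_nth f 1"] by (simp add: fps_mult_nth_1)
  then have "fps_nth g' 1 * (4 * (t + 1)) = fps_nth g 1 - v * fps_nth H 1"
    unfolding c0 h0 by (metis add_diff_cancel_left')
  also have "\<dots> = (t + 1) ^ 2 * v * (4 * (t + 1))"
    unfolding IH h1 by (simp add: algebra_simps power2_eq_square)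
  finally have c1: "fps_nth g' 1 = (t + 1) ^ 2 * v"
    using t1 by (metis mult_right_cancel)
  have "fps_nth g' 0 * fps_nth H 2 + fps_nth g' 1 * fps_nth H 1 + fps_nth g' 2 * fps_nth H 0
      = fps_nth g 2"
    using arg_cong[OF gH, of "\<lambda>f. fps_nth f 2"] by (simp add: fps_mult_nth_2)
  then have "fps_nth g' 2 * (4 * (t + 1)) =
      fps_nth g 2 - (v * fps_nth H 2 + (t + 1) ^ 2 * v * fps_nth H 1)"
    unfolding c0 c1 h0 by (metis add_diff_cancel_left')
  also have "\<dots> = ((t + 1) *
      (18 * (t + 1) ^ 3 - 8 * (t + 1) ^ 2 + 15 * (t + 1) + 2) / 36 * v) * (4 * (t + 1))"
    unfolding IH h1 h2 by (simp add: field_simps power2_eq_square power3_eq_cube)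
  finally have c2: "fps_nth g' 2 = (t + 1) *
      (18 * (t + 1) ^ 3 - 8 * (t + 1) ^ 2 + 15 * (t + 1) + 2) / 36 * v"
    using t1 by (metis mult_right_cancel)
  have "of_nat (Suc n) = t + 1" by (simp add: t_def)
  then show ?case
    unfolding g'_def [symmetric] v_def [symmetric] by (simp only: c0 c1 c2 simp_thms)
qed

theorem mainTheorem3:
  shows "(\<forall>n::nat. n \<ge> 1 \<longrightarrow>
           rademacher_coeff 1 2 n (2 * n) = 1 / (2 ^ (2 * n) * fact n)) \<and>
         (\<forall>n::nat. n \<ge> 2 \<longrightarrow>
           rademacher_coeff 1 2 (n - 1) (2 * n) = of_nat n / (2 ^ (2 * n) * fact (n - 1))) \<and>
         (\<forall>n::nat. n \<ge> 3 \<longrightarrow>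
           rademacher_coeff 1 2 (n - 2) (2 * n) =
             (18 * of_nat n ^ 3 - 8 * of_nat n ^ 2 + 15 * of_nat n + 2)
               / (9 * 2 ^ (2 * n + 2) * fact (n - 1)))"
proof (intro conjI allI impI)
  fix n :: nat
  have fact_n: "fact n = (of_nat n * fact (n - 1) :: complex)" if "n \<ge> 1"
    using that by (simp add: fact_reduce)
  {
    assume "n \<ge> 1"
    then show "rademacher_coeff 1 2 n (2 * n) = 1 / (2 ^ (2 * n) * fact n)"
      using rademacher_coeff_minus_one[of n n] inverse_pole_cofactor_nth[of n] by simp
  next
    assume n: "n \<ge> 2"
    then have "rademacher_coeff 1 2 (n - 1) (2 * n) = of_nat n ^ 2 * (1 / (2 ^ (2 * n) * fact n))"
      using rademacher_coeff_minus_one[of "n - 1" n] inverse_pole_cofactor_nth[of n] by simp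
    also have "\<dots> = of_nat n / (2 ^ (2 * n) * fact (n - 1))"
      using n by (simp add: fact_n power2_eq_square)
    finally show "rademacher_coeff 1 2 (n - 1) (2 * n) = of_nat n / (2 ^ (2 * n) * fact (n - 1))" .
  next
    assume n: "n \<ge> 3"
    let ?p = "18 * of_nat n ^ 3 - 8 * of_nat n ^ 2 + 15 * of_nat n + 2 :: complex"
    have "rademacher_coeff 1 2 (n - 2) (2 * n) =
        of_nat n * ?p / 36 * (1 / (2 ^ (2 * n) * fact n))"
      using n rademacher_coeff_minus_one[of "n - 2" n] inverse_pole_cofactor_nth[of n] by simp
    also have "\<dots> = ?p / (9 * 2 ^ (2 * n + 2) * fact (n - 1))"
      using n by (simp add: fact_n power_add)
    finally show "rademacher_coeff 1 2 (n - 2) (2 * n) = ?p / (9 * 2 ^ (2 * n + 2) * fact (n - 1))" .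
  }
qed

end
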